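(* Under the standing assumptions listed in the context, for every time $t\in\mathcal{T}=\{1,\dots,T\}$, the generalized Nash game in which each prosumer $i\in\mathcal{N}=\{1,\dots,N\}$ solves $$\min_{x_i}\ J_{i,t}(x_i,x_{-i})\quad\text{s.t. } x_i\in X_{i,t}(x_{-i})$$ (with costs $J_{i,t}$ and feasible sets $X_{i,t}(x_{-i})$ of the prosumer energy trading market as defined in the context) has a unique variational generalized Nash equilibrium (v-GNE).
   Context: Network. $\mathcal{N}=\{1,\dots,N\}$ is the set of prosumers; $\mathcal{G}=(\mathcal{N},\mathcal{E})$ is a connected undirected graph; $\mathcal{N}_i$ is the set of neighbours of $i$ and $N_i=|\mathcal{N}_i|$. $\mathcal{E}$ contains both ordered pairs $(i,j),(j,i)$ for each pair of neighbours. Decision variable. $x_i=(p_i^g,p_i^c,p_i^d,p_i^{mg},(p_{i,j}^{tr})_{j\in\mathcal{N}_i})\in\mathbb{R}^{n_i}$, $n_i=4+N_i$; $x=(x_1,\dots,x_N)\in\mathbb{R}^n$, $n=\sum_i n_i$; $x_{-i}$ collects all $x_j$, $j\neq i$. Cost. $$J_{i,t}(x_i,x_{-i})=a_i^g(p_i^g)^2+b_i^gp_i^g+a_i^c(p_i^c)^2+a_i^d(p_i^d)^2+c_t^{mg}p_i^{mg}\sum_{j\in\mathcal{N}}p_j^{mg}+\sum_{j\in\mathcal{N}_i}\left[a^{tr}(p_{i,j}^{tr})^2+d_{i,j}^{tr}p_{i,j}^{tr}\right],$$ with constants $a_i^g,a_i^c,a_i^d,a^{tr},c_t^{mg}>0$,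 $b_i^g\in\mathbb{R}$, $d_{i,j}^{tr}=d_{j,i}^{tr}>0$. Local constraints. $\chi_i$ is the set of $x_i$ with: $p_i^{g,min}\le p_i^g\le p_i^{g,max}$; $0\le p_i^c\le p_i^{c,max}$; $0\le p_i^d\le p_i^{d,max}$; $s_i^{min}\le s_i+\frac{\Delta t}{e_i^{cap}}\left(\eta_i^cp_i^c-\frac{1}{\eta_i^d}p_i^d\right)\le s_i^{max}$, where $s_i$ is the given current state of charge, $0<s_i^{min}<s_i^{max}<1$, and $\Delta t,e_i^{cap},\eta_i^c,\eta_i^d>0$ are constants; $p_{i,j}^{tr,min}\le p_{i,j}^{tr}\le p_{i,j}^{tr,max}$ for $j\in\mathcal{N}_i$, with $p_{i,j}^{tr,min}\le 0\le p_{i,j}^{tr,max}$; and $p_i^{mg}$ in a given compact interval. Power balance. $\Omega_{i,t}=\{x_i\in\chi_i: G_ix_i=p_i^l(t)\}$, where $G_ix_i=p_i^g-p_i^c+p_i^d+p_i^{mg}+\sum_{j\in\mathcal{N}_i}p_{i,j}^{tr}$ and $p_i^l(t)\in\mathbb{R}$ is the given load. Coupling constraints. $p^{mg,min}\le\sum_{i}p_i^{mg}\le p^{mg,max}$, and $p_{i,j}^{tr}+p_{j,i}^{tr}=0$ for all $(i,j)\in\mathcal{E}$. Written as the affine inequalities $\sum_{i\in\mathcal{N}}g_i(x_i)\le 0$ in $\mathbb{R}^m$, $m=2+\sum_iN_i$, $g_i(x_i)=A_ix_i-b_i$: the first two components of $\sum_i g_i$ are $-\sum_ip_i^{mg}+p^{mg,min}$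 and $\sum_ip_i^{mg}-p^{mg,max}$ (with the constants split equally among the $N$ prosumers), and for each $(a,b)\in\mathcal{E}$ there is one further component, equal to $p_{a,b}^{tr}+p_{b,a}^{tr}$ if $a<b$ and to $-(p_{a,b}^{tr}+p_{b,a}^{tr})$ if $a>b$. Feasible sets. $X_t=\{x\in\prod_{i}\Omega_{i,t}:\sum_ig_i(x_i)\le0\}$ and $X_{i,t}(x_{-i})=\{x_i\in\Omega_{i,t}:(x_i,x_{-i})\in X_t\}$. Standing assumptions. (a) Each $\chi_i$ is non-empty, compact and convex. (b) Feasibility: given any $x_{-i}$, the optimization problem of prosumer $i$ at time $t$ is feasible, i.e. $X_{i,t}(x_{-i})\neq\emptyset$. Equilibria. A GNE at time $t$ is $x^*\in X_t$ such that for all $i$, $x_i^*$ minimizes $J_{i,t}(\cdot,x_{-i}^* )$ over $X_{i,t}(x_{-i}^* )$. A v-GNE is a GNE at which all prosumers have the same Lagrange multiplier for the coupling constraints: there exist $\lambda^*\in\mathbb{R}^m$, $\lambda^*\ge0$, and $\mu_i^*\in\mathbb{R}$ such that for every $i$, $x_i^*$ minimizes $J_{i,t}(x_i,x_{-i}^* )+\langle\lambda^*,A_ix_i\rangle+\mu_i^*(G_ix_i-p_i^l(t))$ over $x_i\in\chi_i$, and $\langle\lambda^*,\sum_ig_i(x_i^* )\rangle=0$. *)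

theory Defs
  imports "HOL-Analysis.Analysis"
begin

text \<open>
  The prosumers \<open>1, \<dots>, N\<close> are the elements of a finite linearly ordered type \<open>'n\<close>, so
  \<open>N = CARD('n)\<close>. The order matters only for the signs of the trading components of the
  coupling constraints.
\<close>

record 'n market =
  edges :: "('n \<times> 'n) set"
  a_g :: "'n \<Rightarrow> real"
  b_g :: "'n \<Rightarrow> real"
  a_c :: "'n \<Rightarrow> real"
  a_d :: "'n \<Rightarrow> real"
  a_tr :: real
  d_tr :: "'n \<Rightarrow> 'n \<Rightarrow> real"
  c_mg :: "nat \<Rightarrow> real"
  g_min :: "'n \<Rightarrow> real"
  g_max :: "'n \<Rightarrow> real"
  c_max :: "'n \<Rightarrow> real"
  d_max :: "'n \<Rightarrow> real"
  soc :: "'n \<Rightarrow> real"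
  soc_min :: "'n \<Rightarrow> real"
  soc_max :: "'n \<Rightarrow> real"
  delta_t :: real
  e_cap :: "'n \<Rightarrow> real"
  eta_c :: "'n \<Rightarrow> real"
  eta_d :: "'n \<Rightarrow> real"
  tr_min :: "'n \<Rightarrow> 'n \<Rightarrow> real"
  tr_max :: "'n \<Rightarrow> 'n \<Rightarrow> real"
  mg_lo :: "'n \<Rightarrow> real"         \<comment> \<open>endpoints of the compact interval for the individual \<open>p\<^sub>i\<^sup>m\<^sup>g\<close>\<close>
  mg_hi :: "'n \<Rightarrow> real"
  total_mg_min :: real          \<comment> \<open>bounds in the coupling constraint on the sum of all \<open>p\<^sub>i\<^sup>m\<^sup>g\<close>\<close>
  total_mg_max :: real
  load :: "'n \<Rightarrow> nat \<Rightarrow> real"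

definition neighbours :: "'n market \<Rightarrow> 'n \<Rightarrow> 'n set" where
  "neighbours M i = {j. (i, j) \<in> edges M}"

definition valid_market :: "'n market \<Rightarrow> nat \<Rightarrow> bool" where
  "valid_market M T \<longleftrightarrow>
     sym (edges M) \<and> irrefl (edges M) \<and> (\<forall>i j. (i, j) \<in> (edges M)\<^sup>*) \<and>
     (\<forall>i. a_g M i > 0 \<and> a_c M i > 0 \<and> a_d M i > 0) \<and>
     a_tr M > 0 \<and>
     (\<forall>t\<in>{1..T}. c_mg M t > 0) \<and>
     (\<forall>i. \<forall>j\<in>neighbours M i. d_tr M i j = d_tr M j i \<and> d_tr M i j > 0) \<and>
     (\<forall>i. 0 < soc_min M i \<and> soc_min M i < soc_max M i \<and> soc_max M i < 1) \<and>
     delta_t M > 0 \<and>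
     (\<forall>i. e_cap M i > 0 \<and> eta_c M i > 0 \<and> eta_d M i > 0) \<and>
     (\<forall>i. \<forall>j\<in>neighbours M i. tr_min M i j \<le> 0 \<and> 0 \<le> tr_max M i j)"

text \<open>
  A decision is \<open>(p\<^sup>g, p\<^sup>c, p\<^sup>d, p\<^sup>m\<^sup>g, p\<^sup>t\<^sup>r)\<close>. The trading part is indexed by all prosumers but
  pinned to zero outside the neighbourhood (\<open>decision_space\<close>), so that the decisions
  available to prosumer \<open>i\<close> form a space of dimension \<open>4 + N\<^sub>i\<close>.
\<close>

type_synonym 'n decision = "real \<times> real \<times> real \<times> real \<times> (real ^ 'n)"
type_synonym 'n profile = "('n decision) ^ 'n"

definition p_g :: "('n::finite) decision \<Rightarrow> real" where "p_g = (\<lambda>(g, c, d, m, tr). g)"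
definition p_c :: "('n::finite) decision \<Rightarrow> real" where "p_c = (\<lambda>(g, c, d, m, tr). c)"
definition p_d :: "('n::finite) decision \<Rightarrow> real" where "p_d = (\<lambda>(g, c, d, m, tr). d)"
definition p_mg :: "('n::finite) decision \<Rightarrow> real" where "p_mg = (\<lambda>(g, c, d, m, tr). m)"
definition p_tr :: "('n::finite) decision \<Rightarrow> 'n \<Rightarrow> real" where "p_tr = (\<lambda>(g, c, d, m, tr) j. tr $ j)"

definition decision_space :: "('n::finite) market \<Rightarrow> 'n \<Rightarrow> 'n decision set" where
  "decision_space M i = {y. \<forall>j. j \<notin> neighbours M i \<longrightarrow> p_tr y j = 0}"

text \<open>
  The rivals' decisions \<open>x\<^sub>-\<^sub>i\<close> are represented by a full profile \<open>x\<close> whose \<open>i\<close>-th component is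
  disregarded; \<open>subst_dec x i y\<close> is \<open>(y, x\<^sub>-\<^sub>i)\<close>.
\<close>

definition subst_dec :: "('n::finite) profile \<Rightarrow> 'n \<Rightarrow> 'n decision \<Rightarrow> 'n profile" where
  "subst_dec x i y = (\<chi> j. if j = i then y else x $ j)"

definition cost :: "('n::finite) market \<Rightarrow> nat \<Rightarrow> 'n \<Rightarrow> 'n profile \<Rightarrow> real" where
  "cost M t i x =
     a_g M i * (p_g (x $ i))\<^sup>2 + b_g M i * p_g (x $ i)
     + a_c M i * (p_c (x $ i))\<^sup>2 + a_d M i * (p_d (x $ i))\<^sup>2
     + c_mg M t * p_mg (x $ i) * (\<Sum>j\<in>UNIV. p_mg (x $ j))
     + (\<Sum>j\<in>neighbours M i. a_tr M * (p_tr (x $ i) j)\<^sup>2 + d_tr M i j * p_tr (x $ i) j)"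

definition local_set :: "('n::finite) market \<Rightarrow> 'n \<Rightarrow> 'n decision set" where
  "local_set M i = {y \<in> decision_space M i.
     g_min M i \<le> p_g y \<and> p_g y \<le> g_max M i \<and>
     0 \<le> p_c y \<and> p_c y \<le> c_max M i \<and>
     0 \<le> p_d y \<and> p_d y \<le> d_max M i \<and>
     soc_min M i \<le> soc M i + delta_t M / e_cap M i * (eta_c M i * p_c y - 1 / eta_d M i * p_d y) \<and>
     soc M i + delta_t M / e_cap M i * (eta_c M i * p_c y - 1 / eta_d M i * p_d y) \<le> soc_max M i \<and>
     (\<forall>j\<in>neighbours M i. tr_min M i j \<le> p_tr y j \<and> p_tr y j \<le> tr_max M i j) \<and>
     mg_lo M i \<le> p_mg y \<and> p_mg y \<le> mg_hi M i}"

definition balance :: "('n::finite) market \<Rightarrow> 'n \<Rightarrow> 'n decision \<Rightarrow> real" where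
  "balance M i y = p_g y - p_c y + p_d y + p_mg y + (\<Sum>j\<in>neighbours M i. p_tr y j)"

definition Omega :: "('n::finite) market \<Rightarrow> nat \<Rightarrow> 'n \<Rightarrow> 'n decision set" where
  "Omega M t i = {y \<in> local_set M i. balance M i y = load M i t}"

text \<open>
  The components of \<open>\<real>\<^sup>m\<close>, \<open>m = 2 + (\<Sum>i. N\<^sub>i)\<close>, are labelled by \<open>coupling_index M\<close>, which has
  one label for each ordered edge.
\<close>

datatype 'n coupling = Mg_Lower | Mg_Upper | Trade 'n 'n

definition coupling_index :: "'n market \<Rightarrow> 'n coupling set" where
  "coupling_index M = {Mg_Lower, Mg_Upper} \<union> {Trade a b | a b. (a, b) \<in> edges M}"

text \<open>Component \<open>k\<close> of \<open>A\<^sub>i y\<close>, of \<open>b\<^sub>i\<close> and of \<open>g\<^sub>i y = A\<^sub>i y - b\<^sub>i\<close>.\<close>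

fun A_comp :: "('n::{finite,linorder}) \<Rightarrow> 'n coupling \<Rightarrow> 'n decision \<Rightarrow> real" where
  "A_comp i Mg_Lower y = - p_mg y"
| "A_comp i Mg_Upper y = p_mg y"
| "A_comp i (Trade a b) y =
     (if a < b then 1 else - 1) *
     ((if i = a then p_tr y b else 0) + (if i = b then p_tr y a else 0))"

fun b_comp :: "('n::finite) market \<Rightarrow> 'n \<Rightarrow> 'n coupling \<Rightarrow> real" where
  "b_comp M i Mg_Lower = - total_mg_min M / real CARD('n)"
| "b_comp M i Mg_Upper = total_mg_max M / real CARD('n)"
| "b_comp M i (Trade a b) = 0"

definition g_comp ::
    "('n::{finite,linorder}) market \<Rightarrow> 'n \<Rightarrow> 'n coupling \<Rightarrow> 'n decision \<Rightarrow> real" where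
  "g_comp M i k y = A_comp i k y - b_comp M i k"

definition feasible_set :: "('n::{finite,linorder}) market \<Rightarrow> nat \<Rightarrow> 'n profile set" where
  "feasible_set M t = {x. (\<forall>i. x $ i \<in> Omega M t i) \<and>
     (\<forall>k\<in>coupling_index M. (\<Sum>i\<in>UNIV. g_comp M i k (x $ i)) \<le> 0)}"

definition feasible_set_at ::
    "('n::{finite,linorder}) market \<Rightarrow> nat \<Rightarrow> 'n \<Rightarrow> 'n profile \<Rightarrow> 'n decision set" where
  "feasible_set_at M t i x = {y \<in> Omega M t i. subst_dec x i y \<in> feasible_set M t}"

definition GNE :: "('n::{finite,linorder}) market \<Rightarrow> nat \<Rightarrow> 'n profile \<Rightarrow> bool" where
  "GNE M t x \<longleftrightarrow> x \<in> feasible_set M t \<and>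
     (\<forall>i. is_arg_min (\<lambda>y. cost M t i (subst_dec x i y)) (\<lambda>y. y \<in> feasible_set_at M t i x) (x $ i))"

definition v_GNE :: "('n::{finite,linorder}) market \<Rightarrow> nat \<Rightarrow> 'n profile \<Rightarrow> bool" where
  "v_GNE M t x \<longleftrightarrow> GNE M t x \<and>
     (\<exists>(l :: 'n coupling \<Rightarrow> real) (\<mu> :: 'n \<Rightarrow> real).
        (\<forall>k\<in>coupling_index M. 0 \<le> l k) \<and>
        (\<forall>i. is_arg_min
               (\<lambda>y. cost M t i (subst_dec x i y) + (\<Sum>k\<in>coupling_index M. l k * A_comp i k y)
                     + \<mu> i * (balance M i y - load M i t))
               (\<lambda>y. y \<in> local_set M i) (x $ i)) \<and>
        (\<Sum>k\<in>coupling_index M. l k * (\<Sum>i\<in>UNIV. g_comp M i k (x $ i))) = 0)"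

text \<open>
  Feasibility of every prosumer's problem for all rivals' decisions in a nonempty range
  \<open>D i\<close>. With \<open>D i = UNIV\<close> this is contradictory as soon as there are two prosumers, because
  \<open>feasible_set_at\<close> is empty when the rivals violate their own constraints.
\<close>

definition feasible_on ::
    "('n::{finite,linorder}) market \<Rightarrow> nat \<Rightarrow> ('n \<Rightarrow> 'n profile set) \<Rightarrow> bool" where
  "feasible_on M t D \<longleftrightarrow> (\<forall>i. D i \<noteq> {} \<and> (\<forall>x\<in>D i. feasible_set_at M t i x \<noteq> {}))"

end

theory Submission imports Defs begin

text \<open>
  The only interaction between the costs is the grid term
  \<open>c p\<^sub>i (p\<^sub>1 + \<dots> + p\<^sub>N)\<close>, where \<open>p\<^sub>i\<close> stands for the grid component of prosumer \<open>i\<close>. Its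
  derivative in \<open>p\<^sub>i\<close> is \<open>c (p\<^sub>i + p\<^sub>1 + \<dots> + p\<^sub>N)\<close>, which is also the derivative in \<open>p\<^sub>i\<close> of
  \<open>c/2 ((\<Sum>j. p\<^sub>j\<^sup>2) + (\<Sum>j. p\<^sub>j)\<^sup>2)\<close>. So the game has an exact potential: the function
  \<open>potential\<close>, a quadratic whose second-order part is positive definite on the
  spaces in which the decisions live. The claim is that the v-GNEs are precisely the minimisers of this
  strictly convex function over the compact set of jointly feasible profiles.

  The bridge is the variational inequality
  \<open>(\<Sum>i. slope M t i x (z\<^sub>i - x\<^sub>i)) \<ge> 0\<close> for all jointly feasible \<open>z\<close>
  (\<open>v_GNE_iff_variational_inequality\<close>). A v-GNE satisfies it: the sum over the prosumers of the
  first-order conditions of their Lagrangians contains the coupling constraints only through the common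
  multiplier, and complementary slackness gives that contribution a sign. Conversely,
  the inequality says that \<open>x\<close> solves a linear program. All constraints are affine, which
  guarantees multipliers for this program (\<open>polyhedral_multipliers\<close>, a consequence of Farkas' lemma). The local sets are polyhedral and form a product, so the
  resulting stationarity condition can be read off one prosumer at a time, and it makes \<open>x\<^sub>i\<close> a minimiser
  of the convex Lagrangian of prosumer \<open>i\<close>.

  Existence follows, because a minimiser of the potential satisfies the variational inequality
  (\<open>potential_along\<close>). Uniqueness follows, because adding the inequalities of two solutions \<open>x\<close> and
  \<open>z\<close> bounds the second-order form of \<open>z - x\<close> by zero
  (\<open>sum_slope_diff\<close>, \<open>curvature_nonpos_imp_eq_0\<close>).

  Since all functions are quadratic, derivatives are not taken: the expansion of each function along a
  segment is computed exactly, with coefficients called slope and curvature.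
\<close>

section \<open>Multipliers for linear programs over polyhedra\<close>

text \<open>
  Farkas' lemma. A finitely generated cone is a polyhedron, hence closed; if it missed \<open>- c\<close>, a separating
  hyperplane would provide a direction \<open>d\<close> that contradicts \<open>dual\<close>.
\<close>

lemma farkas:
  fixes a :: "'i \<Rightarrow> 'a::euclidean_space"
  assumes fin: "finite I"
    and dual: "\<And>d. (\<And>i. i \<in> I \<Longrightarrow> a i \<bullet> d \<le> 0) \<Longrightarrow> 0 \<le> c \<bullet> d"
  obtains u where "\<And>i. i \<in> I \<Longrightarrow> 0 \<le> u i" "c + (\<Sum>i\<in>I. u i *\<^sub>R a i) = 0"
proof -
  let ?K = "convex_cone hull (a ` I)"
  let ?S = "{\<Sum>i\<in>I. u i *\<^sub>R a i | u. \<forall>i\<in>I. 0 \<le> u i}"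
  have "- c \<in> ?K"
  proof (rule ccontr)
    assume "- c \<notin> ?K"
    moreover have "closed ?K"
      using fin by (simp add: polyhedron_convex_cone_hull polyhedron_imp_closed)
    ultimately obtain d r where r: "d \<bullet> (- c) < r" and sep: "\<And>y. y \<in> ?K \<Longrightarrow> r < d \<bullet> y"
      using separating_hyperplane_closed_point[OF convex_convex_cone_hull] by blast
    have "r < 0"
      using sep[OF convex_cone_hull_contains_0] by simp
    have "0 \<le> d \<bullet> y" if "y \<in> ?K" for y
    proof (rule ccontr)
      assume "\<not> 0 \<le> d \<bullet> y"
      then have neg: "d \<bullet> y < 0" by simp
      \<comment> \<open>Scaled so that its product with \<open>d\<close> is exactly \<open>r\<close>, which separation forbids.\<close>
      have "(r / (d \<bullet> y)) *\<^sub>R y \<in> ?K"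
        using that neg \<open>r < 0\<close> by (intro convex_cone_hull_mul) (auto simp: divide_nonpos_neg)
      from sep[OF this] show False
        using neg by simp
    qed
    then have "a i \<bullet> (- d) \<le> 0" if "i \<in> I" for i
      using that by (simp add: inner_commute[of "a i"] hull_inc)
    then have "0 \<le> c \<bullet> (- d)"
      by (rule dual)
    then show False
      using r \<open>r < 0\<close> by (simp add: inner_commute)
  qed
  moreover have "?K \<subseteq> ?S"
  proof (rule hull_minimal)
    show "a ` I \<subseteq> ?S"
    proof
      fix y assume "y \<in> a ` I"
      then obtain j where j: "j \<in> I" "y = a j" by auto
      have "y = (\<Sum>i\<in>I. (if i = j then 1 else 0) *\<^sub>R a i)"
        using j fin by (simp add: if_distrib[of "\<lambda>u. u *\<^sub>R _"] cong: if_cong)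
      then show "y \<in> ?S"
        by (intro CollectI exI[of _ "\<lambda>i. if i = j then 1 else 0"]) auto
    qed
    show "convex_cone ?S"
      unfolding convex_cone_iff
    proof (intro conjI ballI allI impI)
      show "0 \<in> ?S"
        by (intro CollectI exI[of _ "\<lambda>_. 0"]) simp
    next
      fix y z assume "y \<in> ?S" "z \<in> ?S"
      then obtain u v where "y = (\<Sum>i\<in>I. u i *\<^sub>R a i)" "\<forall>i\<in>I. 0 \<le> u i"
        "z = (\<Sum>i\<in>I. v i *\<^sub>R a i)" "\<forall>i\<in>I. 0 \<le> v i" by blast
      then show "y + z \<in> ?S"
        by (intro CollectI exI[of _ "\<lambda>i. u i + v i"])
          (auto simp: scaleR_add_left sum.distrib)
    next
      fix y and s :: real assume "y \<in> ?S" "0 \<le> s"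
      then obtain u where "y = (\<Sum>i\<in>I. u i *\<^sub>R a i)" "\<forall>i\<in>I. 0 \<le> u i" by blast
      then show "s *\<^sub>R y \<in> ?S"
        using \<open>0 \<le> s\<close> by (intro CollectI exI[of _ "\<lambda>i. s * u i"])
          (auto simp: scaleR_sum_right)
    qed
  qed
  ultimately obtain u where u: "\<forall>i\<in>I. 0 \<le> u i" "- c = (\<Sum>i\<in>I. u i *\<^sub>R a i)"
    by blast
  from u(2) have "c + (\<Sum>i\<in>I. u i *\<^sub>R a i) = 0"
    by (metis add.right_inverse)
  with u(1) show thesis
    using that by blast
qed

text \<open>
  Inactive constraints tolerate a small step in any direction, and there are only finitely many of
  them; so only the active ones restrict the direction.
\<close>

lemma step_into_polyhedron:
  fixes a :: "'i \<Rightarrow> 'a::euclidean_space"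
  assumes fin: "finite I"
    and feas: "\<And>i. i \<in> I \<Longrightarrow> a i \<bullet> x \<le> b i"
    and dir: "\<And>i. i \<in> I \<Longrightarrow> a i \<bullet> x = b i \<Longrightarrow> a i \<bullet> d \<le> 0"
  obtains s where "0 < s" "\<And>i. i \<in> I \<Longrightarrow> a i \<bullet> (x + s *\<^sub>R d) \<le> b i"
proof -
  have "eventually (\<lambda>s. a i \<bullet> (x + s *\<^sub>R d) \<le> b i) (at_right 0)" if "i \<in> I" for i
  proof (cases "a i \<bullet> x = b i")
    case True
    then show ?thesis
      using dir[OF that True]
      by (intro eventually_mono[OF eventually_at_right_less[of 0]])
        (simp add: inner_add_right mult_nonneg_nonpos)
  next
    case False
    have "((\<lambda>s. a i \<bullet> (x + s *\<^sub>R d)) \<longlongrightarrow> a i \<bullet> x) (at_right 0)"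
      by (auto intro!: tendsto_eq_intros)
    then have "eventually (\<lambda>s. a i \<bullet> (x + s *\<^sub>R d) < b i) (at_right 0)"
      using False feas[OF that] by (intro order_tendstoD(2)) auto
    then show ?thesis
      by (rule eventually_mono) simp
  qed
  then have "eventually (\<lambda>s. \<forall>i\<in>I. a i \<bullet> (x + s *\<^sub>R d) \<le> b i) (at_right 0)"
    using fin by (intro eventually_ball_finite) auto
  then have "eventually (\<lambda>s. 0 < s \<and> (\<forall>i\<in>I. a i \<bullet> (x + s *\<^sub>R d) \<le> b i)) (at_right (0::real))"
    by (intro eventually_conj eventually_at_right_less)
  then obtain s :: real where "0 < s" "\<forall>i\<in>I. a i \<bullet> (x + s *\<^sub>R d) \<le> b i"
    using eventually_happens[of _ "at_right (0::real)"] by (auto simp: trivial_limit_at_right_real)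
  then show thesis
    using that by blast
qed

text \<open>
  Farkas' lemma is applied to the normals of all constraints active at \<open>x\<close>, both the explicit ones and the
  half-spaces that describe \<open>C\<close>. The terms of the latter are nonpositive on \<open>z - x\<close> for \<open>z \<in> C\<close>, and
  dropping them leaves an inequality on \<open>C\<close> that mentions explicit multipliers only.
\<close>

lemma polyhedral_multipliers_inequalities:
  fixes c x :: "'a::euclidean_space" and a :: "'i \<Rightarrow> 'a"
  assumes C: "polyhedron C" and fin: "finite I"
    and x: "x \<in> C" "\<And>i. i \<in> I \<Longrightarrow> a i \<bullet> x \<le> b i"
    and opt: "\<And>z. z \<in> C \<Longrightarrow> (\<And>i. i \<in> I \<Longrightarrow> a i \<bullet> z \<le> b i) \<Longrightarrow> c \<bullet> x \<le> c \<bullet> z"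
  obtains u where "\<And>i. i \<in> I \<Longrightarrow> 0 \<le> u i"
    "\<And>i. i \<in> I \<Longrightarrow> u i * (b i - a i \<bullet> x) = 0"
    "\<And>z. z \<in> C \<Longrightarrow> 0 \<le> c \<bullet> (z - x) + (\<Sum>i\<in>I. u i * (a i \<bullet> (z - x)))"
proof -
  obtain F where F: "finite F" "C = \<Inter>F" "\<forall>h\<in>F. \<exists>n r. n \<noteq> 0 \<and> h = {z. n \<bullet> z \<le> r}"
    using C unfolding polyhedron_def by blast
  from F(3) have "\<exists>n. \<forall>h\<in>F. \<exists>r. h = {z. n h \<bullet> z \<le> r}"
    by (intro bchoice) blast
  then obtain n where "\<forall>h\<in>F. \<exists>r. h = {z. n h \<bullet> z \<le> r}" by blast
  then obtain r where nr: "\<forall>h\<in>F. h = {z. n h \<bullet> z \<le> r h}"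
    by (metis bchoice)
  have C_iff: "z \<in> C \<longleftrightarrow> (\<forall>h\<in>F. n h \<bullet> z \<le> r h)" for z
    using F(2) nr by blast
  let ?\<alpha> = "case_sum a n" and ?\<beta> = "case_sum b r" and ?L = "I <+> F"
  let ?J = "{j \<in> ?L. ?\<alpha> j \<bullet> x = ?\<beta> j}"
  have finL: "finite ?L"
    using fin F(1) by simp
  have feas: "?\<alpha> j \<bullet> x \<le> ?\<beta> j" if "j \<in> ?L" for j
    using that x C_iff by auto
  have "0 \<le> c \<bullet> d" if d: "\<And>j. j \<in> ?J \<Longrightarrow> ?\<alpha> j \<bullet> d \<le> 0" for d
  proof -
    obtain s where s: "0 < s" "\<And>j. j \<in> ?L \<Longrightarrow> ?\<alpha> j \<bullet> (x + s *\<^sub>R d) \<le> ?\<beta> j"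
      using step_into_polyhedron[OF finL, of ?\<alpha> x ?\<beta> d] feas d by blast
    have "c \<bullet> x \<le> c \<bullet> (x + s *\<^sub>R d)"
    proof (rule opt)
      show "x + s *\<^sub>R d \<in> C"
        using s(2)[OF InrI] by (auto simp: C_iff)
      show "a i \<bullet> (x + s *\<^sub>R d) \<le> b i" if "i \<in> I" for i
        using s(2)[OF InlI[OF that]] by simp
    qed
    then show ?thesis
      using s(1) by (simp add: inner_add_right zero_le_mult_iff)
  qed
  moreover have "finite ?J"
    using finL by simp
  ultimately obtain u where u: "\<And>j. j \<in> ?J \<Longrightarrow> 0 \<le> u j" "c + (\<Sum>j\<in>?J. u j *\<^sub>R ?\<alpha> j) = 0"
    using farkas[of ?J ?\<alpha> c] by blast
  define w where "w j = (if j \<in> ?J then u j else 0)" for j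
  have w: "0 \<le> w j" "w j * (?\<beta> j - ?\<alpha> j \<bullet> x) = 0" for j
    using u(1) by (auto simp: w_def)
  have "(\<Sum>j\<in>?J. u j *\<^sub>R ?\<alpha> j) = (\<Sum>j\<in>?L. w j *\<^sub>R ?\<alpha> j)"
    by (rule sum.mono_neutral_cong_left) (use finL in \<open>auto simp: w_def\<close>)
  also have "\<dots> = (\<Sum>i\<in>I. w (Inl i) *\<^sub>R a i) + (\<Sum>h\<in>F. w (Inr h) *\<^sub>R n h)"
    using fin F(1) by (simp add: sum.Plus)
  finally have stat: "c + (\<Sum>i\<in>I. w (Inl i) *\<^sub>R a i) = - (\<Sum>h\<in>F. w (Inr h) *\<^sub>R n h)"
    using u(2) by (simp add: add.assoc eq_neg_iff_add_eq_0)
  show thesis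
  proof (rule that[of "\<lambda>i. w (Inl i)"])
    show "0 \<le> w (Inl i)" for i
      by (rule w)
    show "w (Inl i) * (b i - a i \<bullet> x) = 0" for i
      using w(2)[of "Inl i"] by simp
    fix z assume "z \<in> C"
    have "w (Inr h) * (n h \<bullet> (z - x)) \<le> 0" if "h \<in> F" for h
    proof -
      have "w (Inr h) * (n h \<bullet> (z - x)) = w (Inr h) * (n h \<bullet> z - r h)"
        using w(2)[of "Inr h"] by (auto simp: inner_diff_right)
      also have "\<dots> \<le> 0"
        using \<open>z \<in> C\<close> that w(1)[of "Inr h"] by (simp add: C_iff mult_nonneg_nonpos)
      finally show ?thesis .
    qed
    then have "(\<Sum>h\<in>F. w (Inr h) * (n h \<bullet> (z - x))) \<le> 0"
      by (rule sum_nonpos)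
    moreover have "c \<bullet> (z - x) + (\<Sum>i\<in>I. w (Inl i) * (a i \<bullet> (z - x)))
        = - (\<Sum>h\<in>F. w (Inr h) * (n h \<bullet> (z - x)))"
      using arg_cong[OF stat, of "\<lambda>y. y \<bullet> (z - x)"]
      by (simp add: inner_add_left inner_sum_left)
    ultimately show "0 \<le> c \<bullet> (z - x) + (\<Sum>i\<in>I. w (Inl i) * (a i \<bullet> (z - x)))"
      by simp
  qed
qed

lemma linear_functional_inner:
  fixes f :: "'a::euclidean_space \<Rightarrow> real"
  assumes "linear f"
  shows "f z = adjoint f 1 \<bullet> z"
  using adjoint_works[OF assms, of z 1] by (simp add: inner_commute)

text \<open>
  The form applied to the market: functionals instead of vectors, and equations, each of which is split
  into two opposite inequalities, so that its multiplier is a difference of nonnegative numbers and has no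
  sign.
\<close>

lemma polyhedral_multipliers:
  fixes c :: "'a::euclidean_space \<Rightarrow> real" and a :: "'i \<Rightarrow> 'a \<Rightarrow> real" and e :: "'j \<Rightarrow> 'a \<Rightarrow> real"
  assumes C: "polyhedron C" and fin: "finite I" "finite J"
    and lin: "linear c" "\<And>i. i \<in> I \<Longrightarrow> linear (a i)" "\<And>j. j \<in> J \<Longrightarrow> linear (e j)"
    and x: "x \<in> C" "\<And>i. i \<in> I \<Longrightarrow> a i x \<le> b i" "\<And>j. j \<in> J \<Longrightarrow> e j x = r j"
    and opt: "\<And>z. z \<in> C \<Longrightarrow> (\<And>i. i \<in> I \<Longrightarrow> a i z \<le> b i) \<Longrightarrow> (\<And>j. j \<in> J \<Longrightarrow> e j z = r j)
      \<Longrightarrow> c x \<le> c z"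
  obtains u v where "\<And>i. i \<in> I \<Longrightarrow> 0 \<le> u i"
    "\<And>i. i \<in> I \<Longrightarrow> u i * (b i - a i x) = 0"
    "\<And>z. z \<in> C \<Longrightarrow> 0 \<le> c (z - x) + (\<Sum>i\<in>I. u i * a i (z - x)) + (\<Sum>j\<in>J. v j * e j (z - x))"
proof -
  let ?vec = "\<lambda>f. adjoint f (1::real) :: 'a"
  let ?\<alpha> = "case_sum (\<lambda>i. ?vec (a i)) (case_sum (\<lambda>j. ?vec (e j)) (\<lambda>j. - ?vec (e j)))"
  let ?\<beta> = "case_sum b (case_sum r (\<lambda>j. - r j))"
  let ?L = "I <+> (J <+> J)"
  have ca: "?vec c \<bullet> z = c z" for z
    using linear_functional_inner[OF lin(1)] by simp
  have aa: "?vec (a i) \<bullet> z = a i z" if "i \<in> I" for i z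
    using linear_functional_inner[OF lin(2)[OF that]] by simp
  have ea: "?vec (e j) \<bullet> z = e j z" if "j \<in> J" for j z
    using linear_functional_inner[OF lin(3)[OF that]] by simp
  have "finite ?L"
    using fin by simp
  moreover have "?\<alpha> k \<bullet> x \<le> ?\<beta> k" if "k \<in> ?L" for k
    using that x aa ea by auto
  moreover have "?vec c \<bullet> x \<le> ?vec c \<bullet> z" if "z \<in> C" and z: "\<And>k. k \<in> ?L \<Longrightarrow> ?\<alpha> k \<bullet> z \<le> ?\<beta> k" for z
  proof -
    have "a i z \<le> b i" if "i \<in> I" for i
      using z[of "Inl i"] that aa by auto
    moreover have "e j z = r j" if "j \<in> J" for j
      using z[OF InrI[OF InlI[OF that]]] z[OF InrI[OF InrI[OF that]]] that ea by simp
    ultimately show ?thesis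
      using opt[OF \<open>z \<in> C\<close>] ca by simp
  qed
  ultimately obtain w where w: "\<And>k. k \<in> ?L \<Longrightarrow> 0 \<le> w k"
    "\<And>k. k \<in> ?L \<Longrightarrow> w k * (?\<beta> k - ?\<alpha> k \<bullet> x) = 0"
    "\<And>z. z \<in> C \<Longrightarrow> 0 \<le> ?vec c \<bullet> (z - x) + (\<Sum>k\<in>?L. w k * (?\<alpha> k \<bullet> (z - x)))"
    using polyhedral_multipliers_inequalities[OF C, of ?L x ?\<alpha> ?\<beta> "?vec c"] x(1) by blast
  show thesis
  proof (rule that[of "\<lambda>i. w (Inl i)" "\<lambda>j. w (Inr (Inl j)) - w (Inr (Inr j))"])
    show "0 \<le> w (Inl i)" if "i \<in> I" for i
      using w(1) that by blast
    show "w (Inl i) * (b i - a i x) = 0" if "i \<in> I" for i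
      using w(2)[of "Inl i"] that aa by auto
    fix z assume "z \<in> C"
    have "(\<Sum>k\<in>?L. w k * (?\<alpha> k \<bullet> (z - x))) = (\<Sum>i\<in>I. w (Inl i) * a i (z - x))
        + (\<Sum>j\<in>J. (w (Inr (Inl j)) - w (Inr (Inr j))) * e j (z - x))"
      using fin by (simp add: sum.Plus aa ea sum_subtractf left_diff_distrib sum_negf)
    with w(3)[OF \<open>z \<in> C\<close>] show "0 \<le> c (z - x) + (\<Sum>i\<in>I. w (Inl i) * a i (z - x))
        + (\<Sum>j\<in>J. (w (Inr (Inl j)) - w (Inr (Inr j))) * e j (z - x))"
      by (simp add: ca)
  qed
qed

lemma polyhedron_linear_le:
  fixes f :: "'a::euclidean_space \<Rightarrow> real"
  assumes "linear f"
  shows "polyhedron {z. f z \<le> r}"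
  using polyhedron_halfspace_le[of "adjoint f 1" r] by (simp add: linear_functional_inner[OF assms])

lemma polyhedron_Collect_conj:
  "polyhedron {z. P z} \<Longrightarrow> polyhedron {z. Q z} \<Longrightarrow> polyhedron {z. P z \<and> Q z}"
  by (simp add: Collect_conj_eq)

lemma polyhedron_Collect_all:
  fixes P :: "'i::finite \<Rightarrow> 'a::euclidean_space \<Rightarrow> bool"
  assumes "\<And>i. polyhedron {z. P i z}"
  shows "polyhedron {z. \<forall>i. P i z}"
proof -
  have "{z. \<forall>i. P i z} = \<Inter>(range (\<lambda>i. {z. P i z}))"
    by auto
  also have "polyhedron \<dots>"
    using assms by (intro polyhedron_Inter) auto
  finally show ?thesis .
qed

lemma polyhedron_Collect_imp:
  fixes P :: "'a::euclidean_space \<Rightarrow> bool"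
  assumes "polyhedron {z. P z}"
  shows "polyhedron {z. A \<longrightarrow> P z}"
  using assms by (cases A) auto

section \<open>Linear structure of decisions\<close>

lemma p_decision_simps [simp]:
  fixes y z :: "('n::finite) decision"
  shows "p_g (y + z) = p_g y + p_g z" "p_g (y - z) = p_g y - p_g z" "p_g (s *\<^sub>R y) = s * p_g y"
    "p_c (y + z) = p_c y + p_c z" "p_c (y - z) = p_c y - p_c z" "p_c (s *\<^sub>R y) = s * p_c y"
    "p_d (y + z) = p_d y + p_d z" "p_d (y - z) = p_d y - p_d z" "p_d (s *\<^sub>R y) = s * p_d y"
    "p_mg (y + z) = p_mg y + p_mg z" "p_mg (y - z) = p_mg y - p_mg z" "p_mg (s *\<^sub>R y) = s * p_mg y"
    "p_tr (y + z) j = p_tr y j + p_tr z j" "p_tr (y - z) j = p_tr y j - p_tr z j"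
    "p_tr (s *\<^sub>R y) j = s * p_tr y j"
  by (simp_all add: p_g_def p_c_def p_d_def p_mg_def p_tr_def case_prod_beta)

lemma linear_A_comp: "linear (A_comp i k)"
  by (cases k; rule linearI; simp add: algebra_simps)

lemma linear_balance: "linear (balance M i)"
  by (rule linearI; simp add: balance_def algebra_simps sum.distrib sum_distrib_left)

lemma linear_component:
  fixes f :: "'a::euclidean_space \<Rightarrow> real"
  assumes "linear f"
  shows "linear (\<lambda>z :: 'a ^ 'n. f (z $ i))"
  using assms by (auto intro!: linearI simp: linear_add linear_scale)

lemma finite_coupling_index:
  "finite (coupling_index (M :: ('n::finite) market))"
proof -
  have "{Trade a b | a b. (a, b) \<in> edges M} = (\<lambda>(a, b). Trade a b) ` edges M"
    by auto
  then show ?thesis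
    unfolding coupling_index_def by (metis finite.emptyI finite.insertI finite_UnI finite_code finite_imageI)
qed

text \<open>
  The product of the local sets is cut out by finitely many affine inequalities. Compactness and
  convexity alone would not yield multipliers when the coupling constraints only touch the boundary of this set.
\<close>

lemma polyhedron_local_profiles:
  "polyhedron {z :: ('n::finite) profile. \<forall>i. z $ i \<in> local_set M i}"
proof -
  have le: "polyhedron {z :: 'n profile. f (z $ i) \<le> r}" if "linear f" for f :: "'n decision \<Rightarrow> real" and i r
    using that by (intro polyhedron_linear_le linear_component)
  have ge: "polyhedron {z :: 'n profile. r \<le> f (z $ i)}" if "linear f" for f :: "'n decision \<Rightarrow> real" and i r
    using polyhedron_linear_le[OF linear_compose_neg[OF linear_component[OF that]], of i "- r"] by simp
  have eq: "polyhedron {z :: 'n profile. f (z $ i) = 0}" if "linear f" for f :: "'n decision \<Rightarrow> real" and i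
    using polyhedron_Collect_conj[OF le[OF that, of i 0] ge[OF that, of 0 i]] by (simp add: order_eq_iff)
  have lin: "linear (p_g :: 'n decision \<Rightarrow> real)" "linear (p_c :: 'n decision \<Rightarrow> real)"
    "linear (p_d :: 'n decision \<Rightarrow> real)" "linear (p_mg :: 'n decision \<Rightarrow> real)"
    "\<And>j. linear (\<lambda>y :: 'n decision. p_tr y j)"
    by (rule linearI; simp)+
  \<comment> \<open>Change of the state of charge, the linear part of the battery constraint.\<close>
  define charge where "charge i y = delta_t M / e_cap M i * (eta_c M i * p_c y - 1 / eta_d M i * p_d y)"
    for i and y :: "'n decision"
  have "linear (charge i)" for i
    unfolding charge_def by (rule linearI; simp add: algebra_simps add_divide_distrib)
  then have soc: "polyhedron {z :: 'n profile. soc_min M i \<le> soc M i + charge i (z $ i)}"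
    "polyhedron {z :: 'n profile. soc M i + charge i (z $ i) \<le> soc_max M i}" for i
    using ge[of "charge i" "soc_min M i - soc M i" i] le[of "charge i" i "soc_max M i - soc M i"]
    by (simp_all add: algebra_simps)
  show ?thesis
    unfolding local_set_def decision_space_def charge_def[symmetric] mem_Collect_eq Ball_def
    by (intro polyhedron_Collect_all polyhedron_Collect_conj polyhedron_Collect_imp le ge eq lin soc)
qed

section \<open>Costs along a segment\<close>

definition total_mg :: "('n::finite) profile \<Rightarrow> real" where
  "total_mg x = (\<Sum>j\<in>UNIV. p_mg (x $ j))"

text \<open>
  The cost without the grid term, that is, the part that depends on the prosumer's own decision only.
\<close>

definition own_cost :: "('n::finite) market \<Rightarrow> 'n \<Rightarrow> 'n decision \<Rightarrow> real" where
  "own_cost M i y = a_g M i * (p_g y)\<^sup>2 + b_g M i * p_g y + a_c M i * (p_c y)\<^sup>2 + a_d M i * (p_d y)\<^sup>2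
     + (\<Sum>j\<in>neighbours M i. a_tr M * (p_tr y j)\<^sup>2 + d_tr M i j * p_tr y j)"

definition own_slope :: "('n::finite) market \<Rightarrow> 'n \<Rightarrow> 'n decision \<Rightarrow> 'n decision \<Rightarrow> real" where
  "own_slope M i y v = (2 * a_g M i * p_g y + b_g M i) * p_g v + 2 * a_c M i * p_c y * p_c v
     + 2 * a_d M i * p_d y * p_d v
     + (\<Sum>j\<in>neighbours M i. (2 * a_tr M * p_tr y j + d_tr M i j) * p_tr v j)"

definition own_curvature :: "('n::finite) market \<Rightarrow> 'n \<Rightarrow> 'n decision \<Rightarrow> real" where
  "own_curvature M i v = a_g M i * (p_g v)\<^sup>2 + a_c M i * (p_c v)\<^sup>2 + a_d M i * (p_d v)\<^sup>2
     + (\<Sum>j\<in>neighbours M i. a_tr M * (p_tr v j)\<^sup>2)"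

text \<open>
  The partial derivative of the cost of prosumer \<open>i\<close> in its own decision, in direction \<open>v\<close>. The term
  \<open>p_mg (x $ i)\<close> appears on top of the total because the prosumer's own grid power also enters the price.
\<close>

definition slope :: "('n::finite) market \<Rightarrow> nat \<Rightarrow> 'n \<Rightarrow> 'n profile \<Rightarrow> 'n decision \<Rightarrow> real" where
  "slope M t i x v = own_slope M i (x $ i) v + c_mg M t * (p_mg (x $ i) + total_mg x) * p_mg v"

text \<open>
  The grid terms of the costs cannot simply be added: their sum \<open>c (\<Sum>i. p_mg (x $ i))\<^sup>2\<close> has the wrong
  partial derivatives. The factor one half and the extra sum of squares correct them.
\<close>

definition potential :: "('n::finite) market \<Rightarrow> nat \<Rightarrow> 'n profile \<Rightarrow> real" where
  "potential M t x = (\<Sum>i\<in>UNIV. own_cost M i (x $ i))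
     + c_mg M t / 2 * ((\<Sum>i\<in>UNIV. (p_mg (x $ i))\<^sup>2) + (total_mg x)\<^sup>2)"

text \<open>
  Half of the Hessian form of the potential.
\<close>

definition curvature :: "('n::finite) market \<Rightarrow> nat \<Rightarrow> 'n profile \<Rightarrow> real" where
  "curvature M t w = (\<Sum>i\<in>UNIV. own_curvature M i (w $ i))
     + c_mg M t / 2 * ((\<Sum>i\<in>UNIV. (p_mg (w $ i))\<^sup>2) + (total_mg w)\<^sup>2)"

lemma own_cost_along:
  "own_cost M i (y + s *\<^sub>R v) = own_cost M i y + s * own_slope M i y v + s\<^sup>2 * own_curvature M i v"
proof -
  have "(\<Sum>j\<in>neighbours M i. a_tr M * (p_tr (y + s *\<^sub>R v) j)\<^sup>2 + d_tr M i j * p_tr (y + s *\<^sub>R v) j)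
    = (\<Sum>j\<in>neighbours M i. a_tr M * (p_tr y j)\<^sup>2 + d_tr M i j * p_tr y j)
      + s * (\<Sum>j\<in>neighbours M i. (2 * a_tr M * p_tr y j + d_tr M i j) * p_tr v j)
      + s\<^sup>2 * (\<Sum>j\<in>neighbours M i. a_tr M * (p_tr v j)\<^sup>2)"
    unfolding sum_distrib_left sum.distrib[symmetric]
    by (intro sum.cong refl) (simp add: power2_eq_square algebra_simps)
  then show ?thesis
    unfolding own_cost_def own_slope_def own_curvature_def
    by (simp add: power2_eq_square algebra_simps)
qed

text \<open>
  Twice the curvature, because \<open>own_curvature\<close> is the coefficient of the square of the step, half of the
  second derivative.
\<close>

lemma own_slope_diff:
  "own_slope M i (y + v) v - own_slope M i y v = 2 * own_curvature M i v"
proof -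
  have "(\<Sum>j\<in>neighbours M i. (2 * a_tr M * p_tr (y + v) j + d_tr M i j) * p_tr v j)
    = (\<Sum>j\<in>neighbours M i. (2 * a_tr M * p_tr y j + d_tr M i j) * p_tr v j)
      + 2 * (\<Sum>j\<in>neighbours M i. a_tr M * (p_tr v j)\<^sup>2)"
    unfolding sum_distrib_left sum.distrib[symmetric]
    by (intro sum.cong refl) (simp add: power2_eq_square algebra_simps)
  then show ?thesis
    unfolding own_slope_def own_curvature_def
    by (simp add: power2_eq_square algebra_simps)
qed

lemma linear_slope: "linear (slope M t i x)"
  unfolding slope_def own_slope_def
  by (rule linearI; simp add: algebra_simps sum.distrib sum_distrib_left)

lemma cost_eq_own_cost:
  "cost M t i x = own_cost M i (x $ i) + c_mg M t * p_mg (x $ i) * total_mg x"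
  by (simp add: cost_def own_cost_def total_mg_def)

lemma subst_dec_same [simp]: "subst_dec x i y $ i = y" "subst_dec x i (x $ i) = x"
  by (simp_all add: subst_dec_def vec_eq_iff)

text \<open>
  A sum over all prosumers reacts to a unilateral deviation in a single term. This is used for the total
  grid power, the coupling constraints and the first-order conditions.
\<close>

lemma sum_subst_dec:
  fixes f :: "('n::finite) \<Rightarrow> 'n decision \<Rightarrow> real"
  shows "(\<Sum>j\<in>UNIV. f j (subst_dec x i y $ j)) = (\<Sum>j\<in>UNIV. f j (x $ j)) + (f i y - f i (x $ i))"
proof -
  have "(\<Sum>j\<in>UNIV - {i}. f j (subst_dec x i y $ j)) = (\<Sum>j\<in>UNIV - {i}. f j (x $ j))"
    by (intro sum.cong) (auto simp: subst_dec_def)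
  then show ?thesis
    by (simp add: sum.remove[of UNIV i])
qed

text \<open>
  Here the grid curvature is \<open>c_mg M t\<close> and not half of it: a deviation of prosumer \<open>i\<close> changes both factors of
  its grid term.
\<close>

lemma cost_along:
  "cost M t i (subst_dec x i (x $ i + s *\<^sub>R v))
    = cost M t i x + s * slope M t i x v + s\<^sup>2 * (own_curvature M i v + c_mg M t * (p_mg v)\<^sup>2)"
proof -
  have "total_mg (subst_dec x i (x $ i + s *\<^sub>R v)) = total_mg x + s * p_mg v"
    unfolding total_mg_def by (simp add: sum_subst_dec[of "\<lambda>_. p_mg"])
  then show ?thesis
    by (simp add: cost_eq_own_cost slope_def own_cost_along power2_eq_square algebra_simps)
qed

lemma total_mg_along: "total_mg (x + s *\<^sub>R w) = total_mg x + s * total_mg w"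
  by (simp add: total_mg_def sum.distrib sum_distrib_left)

lemma sum_slope:
  "(\<Sum>i\<in>UNIV. slope M t i x (w $ i)) = (\<Sum>i\<in>UNIV. own_slope M i (x $ i) (w $ i))
    + c_mg M t * ((\<Sum>i\<in>UNIV. p_mg (x $ i) * p_mg (w $ i)) + total_mg x * total_mg w)"
  unfolding slope_def total_mg_def[of w]
  by (simp add: sum.distrib sum_distrib_left algebra_simps)

text \<open>
  The potential property: its first-order part is the sum of the prosumers' own slopes.
\<close>

lemma potential_along:
  "potential M t (x + s *\<^sub>R w)
    = potential M t x + s * (\<Sum>i\<in>UNIV. slope M t i x (w $ i)) + s\<^sup>2 * curvature M t w"
proof -
  have "(\<Sum>i\<in>UNIV. (p_mg ((x + s *\<^sub>R w) $ i))\<^sup>2) = (\<Sum>i\<in>UNIV. (p_mg (x $ i))\<^sup>2)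
      + 2 * s * (\<Sum>i\<in>UNIV. p_mg (x $ i) * p_mg (w $ i)) + s\<^sup>2 * (\<Sum>i\<in>UNIV. (p_mg (w $ i))\<^sup>2)"
    unfolding sum_distrib_left sum.distrib[symmetric]
    by (intro sum.cong refl) (simp add: power2_eq_square algebra_simps)
  moreover have "(\<Sum>i\<in>UNIV. own_cost M i ((x + s *\<^sub>R w) $ i)) = (\<Sum>i\<in>UNIV. own_cost M i (x $ i))
      + s * (\<Sum>i\<in>UNIV. own_slope M i (x $ i) (w $ i)) + s\<^sup>2 * (\<Sum>i\<in>UNIV. own_curvature M i (w $ i))"
    by (simp add: own_cost_along sum.distrib sum_distrib_left)
  ultimately show ?thesis
    unfolding potential_def curvature_def sum_slope total_mg_along
    by (simp add: power2_eq_square field_simps)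
qed

text \<open>
  Strong monotonicity of the pseudo-gradient, with its exact defect.
\<close>

lemma sum_slope_diff:
  "(\<Sum>i\<in>UNIV. slope M t i (x + w) (w $ i)) - (\<Sum>i\<in>UNIV. slope M t i x (w $ i)) = 2 * curvature M t w"
proof -
  have "(\<Sum>i\<in>UNIV. own_slope M i ((x + w) $ i) (w $ i)) - (\<Sum>i\<in>UNIV. own_slope M i (x $ i) (w $ i))
      = 2 * (\<Sum>i\<in>UNIV. own_curvature M i (w $ i))"
    by (simp add: sum_subtractf[symmetric] own_slope_diff sum_distrib_left)
  moreover have "(\<Sum>i\<in>UNIV. p_mg ((x + w) $ i) * p_mg (w $ i))
      = (\<Sum>i\<in>UNIV. p_mg (x $ i) * p_mg (w $ i)) + (\<Sum>i\<in>UNIV. (p_mg (w $ i))\<^sup>2)"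
    by (simp add: sum.distrib[symmetric] power2_eq_square algebra_simps)
  moreover have "total_mg (x + w) = total_mg x + total_mg w"
    using total_mg_along[of x 1 w] by simp
  ultimately show ?thesis
    unfolding curvature_def sum_slope
    by (simp add: power2_eq_square algebra_simps)
qed

lemma own_curvature_nonneg:
  assumes "valid_market M T"
  shows "0 \<le> own_curvature M i v"
  using assms unfolding valid_market_def own_curvature_def
  by (intro add_nonneg_nonneg sum_nonneg mult_nonneg_nonneg) (auto intro: less_imp_le)

text \<open>
  The curvature sees trades with neighbours only; the remaining trading components vanish because \<open>v\<close> lies in
  the decision space.
\<close>

lemma own_curvature_eq_0:
  assumes M: "valid_market M T" and "v \<in> decision_space M i"
    and "own_curvature M i v = 0" "p_mg v = 0"
  shows "v = 0"
proof -
  have pos: "0 < a_g M i" "0 < a_c M i" "0 < a_d M i" "0 < a_tr M"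
    using M by (auto simp: valid_market_def)
  then have nn: "0 \<le> a_g M i * (p_g v)\<^sup>2" "0 \<le> a_c M i * (p_c v)\<^sup>2" "0 \<le> a_d M i * (p_d v)\<^sup>2"
      "0 \<le> (\<Sum>j\<in>neighbours M i. a_tr M * (p_tr v j)\<^sup>2)"
    by (auto intro!: sum_nonneg)
  with assms(3) have z: "a_g M i * (p_g v)\<^sup>2 = 0" "a_c M i * (p_c v)\<^sup>2 = 0" "a_d M i * (p_d v)\<^sup>2 = 0"
      "(\<Sum>j\<in>neighbours M i. a_tr M * (p_tr v j)\<^sup>2) = 0"
    unfolding own_curvature_def by linarith+
  from z(4) have "p_tr v j = 0" if "j \<in> neighbours M i" for j
    using that pos(4) by (subst (asm) sum_nonneg_eq_0_iff) auto
  with assms(2) have "p_tr v j = 0" for j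
    by (auto simp: decision_space_def)
  moreover have "p_g v = 0" "p_c v = 0" "p_d v = 0"
    using z pos by auto
  ultimately show ?thesis
    using assms(4) by (cases v) (simp add: p_g_def p_c_def p_d_def p_mg_def p_tr_def vec_eq_iff zero_prod_def)
qed

lemma curvature_nonpos_imp_eq_0:
  assumes M: "valid_market M T" and t: "t \<in> {1..T}"
    and w: "\<And>i. w $ i \<in> decision_space M i" and le: "curvature M t w \<le> 0"
  shows "w = 0"
proof -
  have c: "0 < c_mg M t"
    using M t by (auto simp: valid_market_def)
  have nn: "0 \<le> (\<Sum>i\<in>UNIV. own_curvature M i (w $ i))" "0 \<le> (\<Sum>i\<in>UNIV. (p_mg (w $ i))\<^sup>2)"
      "0 \<le> (total_mg w)\<^sup>2"
    by (simp_all add: sum_nonneg own_curvature_nonneg[OF M])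
  then have "0 \<le> c_mg M t / 2 * ((\<Sum>i\<in>UNIV. (p_mg (w $ i))\<^sup>2) + (total_mg w)\<^sup>2)"
    using c by (intro mult_nonneg_nonneg) auto
  with le nn(1) have "(\<Sum>i\<in>UNIV. own_curvature M i (w $ i)) = 0"
      "c_mg M t / 2 * ((\<Sum>i\<in>UNIV. (p_mg (w $ i))\<^sup>2) + (total_mg w)\<^sup>2) = 0"
    unfolding curvature_def by linarith+
  moreover from this(2) c nn have "(\<Sum>i\<in>UNIV. (p_mg (w $ i))\<^sup>2) = 0"
    by (simp add: add_nonneg_eq_0_iff)
  ultimately have "own_curvature M i (w $ i) = 0" "p_mg (w $ i) = 0" for i
    using own_curvature_nonneg[OF M] by (simp_all add: sum_nonneg_eq_0_iff)
  then show ?thesis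
    using own_curvature_eq_0[OF M w] by (simp add: vec_eq_iff)
qed

section \<open>Equilibria as solutions of a variational inequality\<close>

text \<open>
  The first-order necessary condition for a quadratic in the step \<open>s\<close>: divide by \<open>s\<close> and let it tend to zero.
\<close>

lemma linear_part_nonneg:
  fixes p q :: real
  assumes "\<And>s. 0 < s \<Longrightarrow> s \<le> 1 \<Longrightarrow> 0 \<le> s * p + s\<^sup>2 * q"
  shows "0 \<le> p"
proof -
  have "eventually (\<lambda>s. 0 \<le> p + s * q) (at_right 0)"
    unfolding eventually_at_right_field
  proof (intro exI[of _ 1] conjI allI impI)
    fix s :: real assume "0 < s" "s < 1"
    with assms[of s] have "0 \<le> s * (p + s * q)"
      by (simp add: power2_eq_square algebra_simps)
    with \<open>0 < s\<close> show "0 \<le> p + s * q"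
      by (simp add: zero_le_mult_iff)
  qed simp
  moreover have "((\<lambda>s. p + s * q) \<longlongrightarrow> p) (at_right 0)"
    by (auto intro!: tendsto_eq_intros)
  ultimately show ?thesis
    by (intro tendsto_lowerbound) auto
qed

lemma convex_combination_along:
  fixes x z :: "'a::real_vector"
  assumes "convex S" "x \<in> S" "z \<in> S" "0 < s" "s \<le> 1"
  shows "x + s *\<^sub>R (z - x) \<in> S"
  using convexD[OF assms(1-3), of "1 - s" s] assms(4,5) by (simp add: algebra_simps)

definition lagrangian ::
    "('n::{finite,linorder}) market \<Rightarrow> nat \<Rightarrow> ('n coupling \<Rightarrow> real) \<Rightarrow> ('n \<Rightarrow> real) \<Rightarrow> 'n profile \<Rightarrow> 'n
      \<Rightarrow> 'n decision \<Rightarrow> real" where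
  "lagrangian M t l \<mu> x i y = cost M t i (subst_dec x i y)
     + (\<Sum>k\<in>coupling_index M. l k * A_comp i k y) + \<mu> i * (balance M i y - load M i t)"

definition lagrangian_slope ::
    "('n::{finite,linorder}) market \<Rightarrow> nat \<Rightarrow> ('n coupling \<Rightarrow> real) \<Rightarrow> ('n \<Rightarrow> real) \<Rightarrow> 'n profile \<Rightarrow> 'n
      \<Rightarrow> 'n decision \<Rightarrow> real" where
  "lagrangian_slope M t l \<mu> x i v = slope M t i x v
     + (\<Sum>k\<in>coupling_index M. l k * A_comp i k v) + \<mu> i * balance M i v"

lemma lagrangian_along:
  "lagrangian M t l \<mu> x i (x $ i + s *\<^sub>R v) = lagrangian M t l \<mu> x i (x $ i)
    + s * lagrangian_slope M t l \<mu> x i v + s\<^sup>2 * (own_curvature M i v + c_mg M t * (p_mg v)\<^sup>2)"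
  unfolding lagrangian_def lagrangian_slope_def cost_along
  by (simp add: linear_add[OF linear_A_comp] linear_scale[OF linear_A_comp]
      linear_add[OF linear_balance] linear_scale[OF linear_balance] algebra_simps
      sum.distrib sum_distrib_left)

text \<open>
  Over a convex set, minimality of a convex quadratic is equivalent to its first-order condition. The
  equivalence turns the minimisations in the definition of a v-GNE into linear inequalities, which can be
  summed over the prosumers and produced by linear programming duality.
\<close>

lemma lagrangian_minimal_iff:
  assumes M: "valid_market M T" and t: "t \<in> {1..T}" and conv: "convex (local_set M i)"
  shows "is_arg_min (lagrangian M t l \<mu> x i) (\<lambda>y. y \<in> local_set M i) (x $ i) \<longleftrightarrow>
    x $ i \<in> local_set M i \<and> (\<forall>y\<in>local_set M i. 0 \<le> lagrangian_slope M t l \<mu> x i (y - x $ i))"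
    (is "?min \<longleftrightarrow> ?vi")
proof
  assume min: ?min
  have "0 \<le> lagrangian_slope M t l \<mu> x i (y - x $ i)" if y: "y \<in> local_set M i" for y
  proof (rule linear_part_nonneg)
    fix s :: real assume "0 < s" "s \<le> 1"
    then have "x $ i + s *\<^sub>R (y - x $ i) \<in> local_set M i"
      using min y conv by (intro convex_combination_along) (simp_all add: is_arg_min_def)
    then have "lagrangian M t l \<mu> x i (x $ i) \<le> lagrangian M t l \<mu> x i (x $ i + s *\<^sub>R (y - x $ i))"
      using min unfolding is_arg_min_linorder by blast
    then show "0 \<le> s * lagrangian_slope M t l \<mu> x i (y - x $ i)
        + s\<^sup>2 * (own_curvature M i (y - x $ i) + c_mg M t * (p_mg (y - x $ i))\<^sup>2)"
      unfolding lagrangian_along by linarith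
  qed
  with min show ?vi
    by (simp add: is_arg_min_def)
next
  assume vi: ?vi
  have "lagrangian M t l \<mu> x i (x $ i) \<le> lagrangian M t l \<mu> x i y" if "y \<in> local_set M i" for y
  proof -
    have "0 < c_mg M t"
      using M t by (auto simp: valid_market_def)
    then have "0 \<le> own_curvature M i (y - x $ i) + c_mg M t * (p_mg (y - x $ i))\<^sup>2"
      using own_curvature_nonneg[OF M] by (intro add_nonneg_nonneg mult_nonneg_nonneg) auto
    with vi that lagrangian_along[of M t l \<mu> x i 1 "y - x $ i"] show ?thesis
      by simp
  qed
  with vi show ?min
    by (simp add: is_arg_min_linorder)
qed

text \<open>
  Sharing one multiplier among the prosumers amounts to letting all of them deviate jointly within
  the coupled feasible set, which is what the right-hand side tests.
\<close>

lemma v_GNE_iff_variational_inequality: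
  fixes M :: "('n::{finite,linorder}) market"
  assumes M: "valid_market M T" and t: "t \<in> {1..T}" and conv: "\<And>i. convex (local_set M i)"
  shows "v_GNE M t x \<longleftrightarrow> x \<in> feasible_set M t \<and>
    (\<forall>z\<in>feasible_set M t. 0 \<le> (\<Sum>i\<in>UNIV. slope M t i x (z $ i - x $ i)))"
    (is "_ \<longleftrightarrow> _ \<and> ?vi")
proof
  let ?K = "coupling_index M"
  assume v: "v_GNE M t x"
  then have x: "x \<in> feasible_set M t"
    by (simp add: v_GNE_def GNE_def)
  from v obtain l \<mu> where l: "\<forall>k\<in>?K. 0 \<le> l k"
    and min: "\<And>i. is_arg_min (lagrangian M t l \<mu> x i) (\<lambda>y. y \<in> local_set M i) (x $ i)"
    and slack: "(\<Sum>k\<in>?K. l k * (\<Sum>i\<in>UNIV. g_comp M i k (x $ i))) = 0"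
    unfolding v_GNE_def lagrangian_def by blast
  \<comment> \<open>Sum of the first-order conditions at \<open>z\<close>: the balance terms cancel, and the coupling terms are
    nonpositive because \<open>z\<close> is feasible while \<open>x\<close> satisfies complementary slackness.\<close>
  have "0 \<le> (\<Sum>i\<in>UNIV. slope M t i x (z $ i - x $ i))" if z: "z \<in> feasible_set M t" for z
  proof -
    have bal: "balance M i (z $ i - x $ i) = 0" for i
      using x z by (simp add: feasible_set_def Omega_def linear_diff[OF linear_balance])
    have "0 \<le> (\<Sum>i\<in>UNIV. lagrangian_slope M t l \<mu> x i (z $ i - x $ i))"
      using min z unfolding lagrangian_minimal_iff[OF M t conv]
      by (intro sum_nonneg) (auto simp: feasible_set_def Omega_def)
    also have "\<dots> = (\<Sum>i\<in>UNIV. slope M t i x (z $ i - x $ i))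
        + (\<Sum>k\<in>?K. l k * (\<Sum>i\<in>UNIV. A_comp i k (z $ i - x $ i)))"
      unfolding lagrangian_slope_def bal sum_distrib_left
      by (subst sum.swap[of _ UNIV ?K]) (simp add: sum.distrib)
    also have "(\<Sum>k\<in>?K. l k * (\<Sum>i\<in>UNIV. A_comp i k (z $ i - x $ i)))
        = (\<Sum>k\<in>?K. l k * (\<Sum>i\<in>UNIV. g_comp M i k (z $ i)))
          - (\<Sum>k\<in>?K. l k * (\<Sum>i\<in>UNIV. g_comp M i k (x $ i)))"
      by (simp add: g_comp_def linear_diff[OF linear_A_comp] sum_subtractf algebra_simps)
    also have "\<dots> \<le> 0"
      unfolding slack diff_0_right
      by (rule sum_nonpos, rule mult_nonneg_nonpos) (use l z in \<open>auto simp: feasible_set_def\<close>)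
    finally show ?thesis
      by simp
  qed
  with x show "x \<in> feasible_set M t \<and> ?vi"
    by blast
next
  let ?K = "coupling_index M"
  let ?C = "{z :: 'n profile. \<forall>i. z $ i \<in> local_set M i}"
  let ?A = "\<lambda>k (z :: 'n profile). \<Sum>i\<in>UNIV. A_comp i k (z $ i)"
  let ?b = "\<lambda>k. \<Sum>i\<in>UNIV. b_comp M i k"
  assume "x \<in> feasible_set M t \<and> ?vi"
  then have x: "x \<in> feasible_set M t" and vi: ?vi
    by auto
  have feasible: "z \<in> feasible_set M t \<longleftrightarrow>
      z \<in> ?C \<and> (\<forall>k\<in>?K. ?A k z \<le> ?b k) \<and> (\<forall>i. balance M i (z $ i) = load M i t)" for z
    by (auto simp: feasible_set_def Omega_def g_comp_def sum_subtractf)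
  have slope_sub: "(\<Sum>i\<in>UNIV. slope M t i x ((z - x) $ i))
      = (\<Sum>i\<in>UNIV. slope M t i x (z $ i)) - (\<Sum>i\<in>UNIV. slope M t i x (x $ i))" for z
    by (simp add: linear_diff[OF linear_slope] sum_subtractf)
  \<comment> \<open>\<open>x\<close> minimises the linear functional given by its own slopes. The local constraints stay in the set
    \<open>?C\<close>; only the coupling and balance constraints receive multipliers.\<close>
  obtain l \<mu> where l: "\<And>k. k \<in> ?K \<Longrightarrow> 0 \<le> l k"
    and slack: "\<And>k. k \<in> ?K \<Longrightarrow> l k * (?b k - ?A k x) = 0"
    and stat: "\<And>z. z \<in> ?C \<Longrightarrow> 0 \<le> (\<Sum>i\<in>UNIV. slope M t i x ((z - x) $ i))
      + (\<Sum>k\<in>?K. l k * ?A k (z - x)) + (\<Sum>i\<in>UNIV. \<mu> i * balance M i ((z - x) $ i))"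
  proof (rule polyhedral_multipliers[where C = ?C and I = ?K and J = "UNIV :: 'n set"
        and c = "\<lambda>z. \<Sum>i\<in>UNIV. slope M t i x (z $ i)" and a = ?A
        and e = "\<lambda>i z. balance M i (z $ i)" and b = ?b and r = "\<lambda>i. load M i t" and x = x])
    show "(\<Sum>i\<in>UNIV. slope M t i x (x $ i)) \<le> (\<Sum>i\<in>UNIV. slope M t i x (z $ i))"
      if "z \<in> ?C" "\<And>k. k \<in> ?K \<Longrightarrow> ?A k z \<le> ?b k" "\<And>i. i \<in> UNIV \<Longrightarrow> balance M i (z $ i) = load M i t" for z
    proof -
      have "z \<in> feasible_set M t"
        using that by (simp add: feasible)
      from bspec[OF vi this] slope_sub[of z] show ?thesis
        by simp
    qed
  qed (use x in \<open>auto simp: feasible finite_coupling_index polyhedron_local_profiles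
        intro!: linear_compose_sum linear_component linear_slope linear_A_comp linear_balance\<close>)
  have zero: "slope M t i x 0 = 0" "A_comp i k 0 = 0" "balance M i 0 = 0" for i k
    by (simp_all add: linear_0 linear_slope linear_A_comp linear_balance)
  \<comment> \<open>\<open>?C\<close> is a product, so \<open>stat\<close> may be evaluated at profiles that differ from \<open>x\<close> in one component.\<close>
  have min: "is_arg_min (lagrangian M t l \<mu> x i) (\<lambda>y. y \<in> local_set M i) (x $ i)" for i
    unfolding lagrangian_minimal_iff[OF M t conv]
  proof (intro conjI ballI)
    show "x $ i \<in> local_set M i"
      using x by (simp add: feasible)
    fix y assume "y \<in> local_set M i"
    with x have "subst_dec x i y \<in> ?C"
      by (simp add: feasible subst_dec_def)
    note stat = stat[OF this]
    have single: "(\<Sum>j\<in>UNIV. f j ((subst_dec x i y - x) $ j)) = f i (y - x $ i)"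
      if "\<And>j. f j 0 = 0" for f :: "'n \<Rightarrow> 'n decision \<Rightarrow> real"
      using sum_subst_dec[of "\<lambda>j v. f j (v - x $ j)" x i y] that by simp
    have "(\<Sum>j\<in>UNIV. A_comp j k ((subst_dec x i y - x) $ j)) = A_comp i k (y - x $ i)" for k
      by (intro single zero)
    moreover have "(\<Sum>j\<in>UNIV. slope M t j x ((subst_dec x i y - x) $ j)) = slope M t i x (y - x $ i)"
      by (intro single zero)
    moreover have "(\<Sum>j\<in>UNIV. \<mu> j * balance M j ((subst_dec x i y - x) $ j)) = \<mu> i * balance M i (y - x $ i)"
      by (intro single) (simp add: zero)
    ultimately show "0 \<le> lagrangian_slope M t l \<mu> x i (y - x $ i)"
      using stat unfolding lagrangian_slope_def by simp
  qed
  have slack_sum: "(\<Sum>k\<in>?K. l k * (\<Sum>i\<in>UNIV. g_comp M i k (x $ i))) = 0"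
  proof (intro sum.neutral ballI)
    fix k assume "k \<in> ?K"
    from slack[OF this] show "l k * (\<Sum>i\<in>UNIV. g_comp M i k (x $ i)) = 0"
      by (auto simp: g_comp_def sum_subtractf)
  qed
  \<comment> \<open>Weak duality: on the set of feasible deviations the multiplier terms are largest at \<open>x $ i\<close>, so a
    minimiser of the Lagrangian also minimises the cost.\<close>
  have "is_arg_min (\<lambda>y. cost M t i (subst_dec x i y)) (\<lambda>y. y \<in> feasible_set_at M t i x) (x $ i)" for i
  proof -
    have "cost M t i (subst_dec x i (x $ i)) \<le> cost M t i (subst_dec x i y)"
      if y: "y \<in> feasible_set_at M t i x" for y
    proof -
      have "lagrangian M t l \<mu> x i (x $ i) \<le> lagrangian M t l \<mu> x i y"
        using min[of i] y unfolding is_arg_min_linorder feasible_set_at_def Omega_def by blast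
      moreover have "balance M i y = load M i t" "balance M i (x $ i) = load M i t"
        using x y by (auto simp: feasible_set_at_def Omega_def feasible)
      moreover have "(\<Sum>k\<in>?K. l k * A_comp i k y) \<le> (\<Sum>k\<in>?K. l k * A_comp i k (x $ i))"
      proof -
        have "(\<Sum>k\<in>?K. l k * (\<Sum>j\<in>UNIV. g_comp M j k (subst_dec x i y $ j))) \<le> 0"
          by (rule sum_nonpos, rule mult_nonneg_nonpos)
            (use y l in \<open>auto simp: feasible_set_at_def feasible_set_def\<close>)
        moreover have "(\<Sum>j\<in>UNIV. g_comp M j k (subst_dec x i y $ j))
            = (\<Sum>j\<in>UNIV. g_comp M j k (x $ j)) + (g_comp M i k y - g_comp M i k (x $ i))" for k
          by (rule sum_subst_dec)
        ultimately show ?thesis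
          using slack_sum
          by (simp add: g_comp_def distrib_left right_diff_distrib sum.distrib sum_subtractf)
      qed
      ultimately show ?thesis
        by (simp add: lagrangian_def)
    qed
    moreover have "x $ i \<in> feasible_set_at M t i x"
      using x by (simp add: feasible_set_at_def) (simp add: feasible_set_def)
    ultimately show ?thesis
      unfolding is_arg_min_linorder by blast
  qed
  with x have "GNE M t x"
    by (simp add: GNE_def)
  with l min slack_sum show "v_GNE M t x"
    unfolding v_GNE_def lagrangian_def by blast
qed

section \<open>Existence and uniqueness\<close>

lemma convex_feasible_set:
  fixes M :: "('n::{finite,linorder}) market"
  assumes "\<And>i. convex (local_set M i)"
  shows "convex (feasible_set M t)"
proof (rule convexI)
  fix x z :: "'n profile" and u v :: real
  assume x: "x \<in> feasible_set M t" and z: "z \<in> feasible_set M t"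
    and uv: "0 \<le> u" "0 \<le> v" "u + v = 1"
  have "u *\<^sub>R x $ i + v *\<^sub>R z $ i \<in> Omega M t i" for i
  proof -
    have "u *\<^sub>R x $ i + v *\<^sub>R z $ i \<in> local_set M i"
      using x z uv by (intro convexD[OF assms]) (auto simp: feasible_set_def Omega_def)
    moreover have "balance M i (u *\<^sub>R x $ i + v *\<^sub>R z $ i) = (u + v) * load M i t"
      using x z by (simp add: linear_add[OF linear_balance] linear_scale[OF linear_balance]
          feasible_set_def Omega_def distrib_right)
    ultimately show ?thesis
      using uv by (simp add: Omega_def)
  qed
  moreover have "(\<Sum>i\<in>UNIV. g_comp M i k ((u *\<^sub>R x + v *\<^sub>R z) $ i)) \<le> 0" if "k \<in> coupling_index M" for k
  proof -
    have "g_comp M i k ((u *\<^sub>R x + v *\<^sub>R z) $ i)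
        = u * g_comp M i k (x $ i) + v * g_comp M i k (z $ i) + (u + v - 1) * b_comp M i k" for i
      by (simp add: g_comp_def linear_add[OF linear_A_comp] linear_scale[OF linear_A_comp] algebra_simps)
    then have "(\<Sum>i\<in>UNIV. g_comp M i k ((u *\<^sub>R x + v *\<^sub>R z) $ i))
        = u * (\<Sum>i\<in>UNIV. g_comp M i k (x $ i)) + v * (\<Sum>i\<in>UNIV. g_comp M i k (z $ i))"
      using uv by (simp add: sum.distrib sum_distrib_left)
    also have "\<dots> \<le> 0"
      using x z uv that by (intro add_nonpos_nonpos mult_nonneg_nonpos) (auto simp: feasible_set_def)
    finally show ?thesis .
  qed
  ultimately show "u *\<^sub>R x + v *\<^sub>R z \<in> feasible_set M t"
    by (simp add: feasible_set_def)
qed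

lemma compact_feasible_set:
  fixes M :: "('n::{finite,linorder}) market"
  assumes "\<And>i. compact (local_set M i)"
  shows "compact (feasible_set M t)"
proof -
  have cont: "continuous_on UNIV (\<lambda>z :: 'n profile. f (z $ i))" if "linear f"
    for f :: "'n decision \<Rightarrow> real" and i
    using linear_component[OF that] by (intro linear_continuous_on) (simp add: linear_linear)
  have "feasible_set M t = {z. \<forall>i. z $ i \<in> local_set M i}
      \<inter> (\<Inter>i. {z. balance M i (z $ i) = load M i t})
      \<inter> (\<Inter>k\<in>coupling_index M. {z. (\<Sum>i\<in>UNIV. A_comp i k (z $ i) - b_comp M i k) \<le> 0})"
    by (auto simp: feasible_set_def Omega_def g_comp_def)
  also have "closed \<dots>"
    by (intro closed_Int closed_INT ballI closed_Collect_eq closed_Collect_le continuous_on_sum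
        continuous_on_diff continuous_on_const cont linear_balance linear_A_comp
        polyhedron_imp_closed polyhedron_local_profiles)
  finally have closed: "closed (feasible_set M t)" .
  have "\<exists>B. \<forall>y\<in>local_set M i. norm y \<le> B" for i
    using compact_imp_bounded[OF assms] by (simp add: bounded_iff)
  then obtain B where B: "\<And>i y. y \<in> local_set M i \<Longrightarrow> norm y \<le> B i"
    by metis
  have "norm z \<le> (\<Sum>i\<in>UNIV. B i)" if "z \<in> feasible_set M t" for z
  proof -
    have "norm z \<le> (\<Sum>i\<in>UNIV. norm (z $ i))"
      unfolding norm_vec_def by (rule L2_set_le_sum) simp
    also have "\<dots> \<le> (\<Sum>i\<in>UNIV. B i)"
      using that by (intro sum_mono B) (simp add: feasible_set_def Omega_def)
    finally show ?thesis .
  qed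
  then have "bounded (feasible_set M t)"
    unfolding bounded_iff by blast
  with closed show ?thesis
    by (simp add: compact_eq_bounded_closed)
qed

lemma continuous_on_potential: "continuous_on S (potential M t)"
  unfolding potential_def own_cost_def total_mg_def p_g_def p_c_def p_d_def p_mg_def p_tr_def case_prod_beta
  by (intro continuous_intros)

theorem theorem1:
  fixes M :: "('n::{finite,linorder}) market" and T :: nat
    and D :: "nat \<Rightarrow> 'n \<Rightarrow> 'n profile set"
  assumes "valid_market M T"
    and "\<And>i. local_set M i \<noteq> {} \<and> compact (local_set M i) \<and> convex (local_set M i)"
    and "\<And>t. t \<in> {1..T} \<Longrightarrow> feasible_on M t (D t)"
  shows "\<forall>t\<in>{1..T}. \<exists>!x. v_GNE M t x"
proof
  fix t assume t: "t \<in> {1..T}"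
  let ?X = "feasible_set M t"
  let ?vi = "\<lambda>x. \<forall>z\<in>?X. 0 \<le> (\<Sum>i\<in>UNIV. slope M t i x (z $ i - x $ i))"
  have v_GNE_iff: "v_GNE M t x \<longleftrightarrow> x \<in> ?X \<and> ?vi x" for x
    using assms(1,2) t by (intro v_GNE_iff_variational_inequality) auto
  \<comment> \<open>A feasible response to one choice of rivals' decisions completes them to a jointly feasible profile.\<close>
  have "?X \<noteq> {}"
    using assms(3)[OF t] by (fastforce simp: feasible_on_def feasible_set_at_def)
  then obtain x where x: "x \<in> ?X" and min: "\<And>z. z \<in> ?X \<Longrightarrow> potential M t x \<le> potential M t z"
    using continuous_attains_inf[OF compact_feasible_set _ continuous_on_potential] assms(2) by metis
  have "0 \<le> (\<Sum>i\<in>UNIV. slope M t i x (z $ i - x $ i))" if z: "z \<in> ?X" for z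
  proof (rule linear_part_nonneg)
    fix s :: real assume "0 < s" "s \<le> 1"
    then have "x + s *\<^sub>R (z - x) \<in> ?X"
      using x z assms(2) by (intro convex_combination_along convex_feasible_set) auto
    from min[OF this] show
      "0 \<le> s * (\<Sum>i\<in>UNIV. slope M t i x (z $ i - x $ i)) + s\<^sup>2 * curvature M t (z - x)"
      unfolding potential_along by simp
  qed
  with x have "v_GNE M t x"
    by (simp add: v_GNE_iff)
  moreover have "z = x" if "v_GNE M t z" for z
  proof -
    from that x have z: "z \<in> ?X" "?vi z"
      by (auto simp: v_GNE_iff)
    have "?vi x"
      using \<open>v_GNE M t x\<close> by (simp add: v_GNE_iff)
    have "0 \<le> (\<Sum>i\<in>UNIV. slope M t i x ((z - x) $ i))"
      using \<open>?vi x\<close> z(1) by simp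
    moreover have "(\<Sum>i\<in>UNIV. slope M t i z ((z - x) $ i)) \<le> 0"
    proof -
      have "slope M t i z (x $ i - z $ i) = - slope M t i z ((z - x) $ i)" for i
        using linear_neg[OF linear_slope, of M t i z "(z - x) $ i"] by simp
      with z(2) x show ?thesis
        by (force simp: sum_negf)
    qed
    ultimately have "curvature M t (z - x) \<le> 0"
      using sum_slope_diff[of M t x "z - x"] by simp
    moreover have "(z - x) $ i \<in> decision_space M i" for i
      using x z(1) by (simp add: feasible_set_def Omega_def local_set_def decision_space_def)
    ultimately have "z - x = 0"
      using assms(1) t by (intro curvature_nonpos_imp_eq_0) auto
    then show ?thesis
      by simp
  qed
  ultimately show "\<exists>!x. v_GNE M t x"
    by blast
qed

end
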